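(* Let $p$ be a prime and let $K$ be a field of characteristic $p>0$ equipped with a valuation $v: K^\ast \rightarrow G$ taking values in an ordered abelian group $G$. Let $\mathcal{O}_K=\{\alpha \in K: v(\alpha) \ge 0\}$ and $\mathfrak{m}_K=\{\alpha \in K: v(\alpha) > 0\}$ be the valuation ring and its maximal ideal, and suppose that the residue field $\mathcal{O}_K/\mathfrak{m}_K$ is finite, with $q$ elements. If $f(x) = a_0 x^{n_0} + a_1 x^{n_1} + \cdots + a_k x^{n_k}$ is a polynomial with $k+1$ nonzero coefficients $a_i \in K^\ast$ (the exponents $n_0,\dots,n_k$ being distinct nonnegative integers), then $f$ has at most $q^k$ distinct zeros in $K$.
   Context: Valuations are general Krull valuations written additively: $G$ is a totally ordered abelian group, not assumed to be discrete or of rank one, $v(\alpha\beta)=v(\alpha)+v(\beta)$ and $v(\alpha+\beta)\ge\min\{v(\alpha),v(\beta)\}$, with the convention $v(0)=+\infty$. The field $K$ is not assumed complete. Zeros are counted without multiplicity. *)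

theory Defs
  imports "HOL-Computational_Algebra.Computational_Algebra"
begin

text \<open>
  A Krull valuation \<open>v : K\<^sup>* \<rightarrow> G\<close>, written additively, is modelled by a total function
  that is only constrained on nonzero arguments. The convention \<open>v(0) = +\<infinity>\<close> is rendered by
  admitting \<open>0\<close> explicitly below; the junk value \<open>v 0\<close> is never used.
\<close>

definition valuation :: "('a::field \<Rightarrow> 'g::linordered_ab_group_add) \<Rightarrow> bool" where
  "valuation v \<longleftrightarrow>
     (\<forall>x y. x \<noteq> 0 \<longrightarrow> y \<noteq> 0 \<longrightarrow> v (x * y) = v x + v y) \<and>
     (\<forall>x y. x \<noteq> 0 \<longrightarrow> y \<noteq> 0 \<longrightarrow> x + y \<noteq> 0 \<longrightarrow> v (x + y) \<ge> min (v x) (v y))"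

definition valuation_ring :: "('a::field \<Rightarrow> 'g::linordered_ab_group_add) \<Rightarrow> 'a set" where
  "valuation_ring v = {x. x = 0 \<or> v x \<ge> 0}"

definition valuation_ideal :: "('a::field \<Rightarrow> 'g::linordered_ab_group_add) \<Rightarrow> 'a set" where
  "valuation_ideal v = {x. x = 0 \<or> v x > 0}"

text \<open>
  The underlying set of the residue field: the cosets of the maximal ideal in the valuation
  ring, as classes of congruence modulo that ideal. Only its cardinality is needed.
\<close>

definition residue_field :: "('a::field \<Rightarrow> 'g::linordered_ab_group_add) \<Rightarrow> 'a set set" where
  "residue_field v =
     valuation_ring v //
       {(x, y) \<in> valuation_ring v \<times> valuation_ring v. x - y \<in> valuation_ideal v}"

end

theory Submission imports Defs begin

text \<open>
  Write the nonzero roots in a coset \<open>x (1 + \<M>)\<close> of a root \<open>x\<close> as \<open>x (1 + y)\<close>. The number of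
  values of \<open>y \<noteq> 0\<close> is the number of positive slopes in the Newton polygon of
  \<open>f (x (1 + y)) = \<Sum>\<^sub>u c\<^sub>u y\<^sup>u\<close>, where \<open>c\<^sub>u = \<Sum>\<^sub>i a\<^sub>i x\<^bsup>n\<^sub>i\<^esup> (n\<^sub>i choose u)\<close>. In characteristic \<open>p\<close> the binomial
  coefficients lie in the prime field, whose nonzero elements have value \<open>0\<close>; hence the left ends
  \<open>u\<close> of these edges, together with \<open>u = 0\<close>, index columns of the matrix \<open>(n\<^sub>i choose u)\<close> that are
  linearly independent over the prime field.

  Conversely, if \<open>v x\<close> runs through \<open>l\<close> slopes of the Newton polygon of \<open>f\<close>, then reducing
  modulo \<open>\<M>\<close> shows that in each of \<open>l\<close> rows (the right ends of the edges) the entries in these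
  columns depend on those of the earlier rows. So if each of \<open>l\<close> roots of distinct values sees at
  least \<open>d\<close> relative distances in its coset, then \<open>l + d \<le> k\<close>. A set in which each point sees at
  most \<open>d\<close> distances has at most \<open>q\<^sup>d\<close> elements, and each value is shared by at most \<open>q - 1\<close>
  cosets; adding \<open>0\<close>, there are at most \<open>1 + (q - 1) (1 + q + \<dots> + q\<^bsup>k - 1\<^esup>) = q\<^sup>k\<close> roots.
\<close>

section \<open>Ultrametric arithmetic and integers in the valuation ring\<close>

locale valued_field =
  fixes v :: "'a::field \<Rightarrow> 'g::linordered_ab_group_add"
  assumes valuation: "valuation v"
begin

text \<open>With \<open>vgt\<close>, this builds in the convention that 0 has infinite value: both
  describe balls around 0, and for \<open>g = 0\<close> the valuation ring and its maximal
  ideal.\<close>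

definition vge :: "'g \<Rightarrow> 'a \<Rightarrow> bool" where
  "vge g x \<longleftrightarrow> x = 0 \<or> g \<le> v x"

definition vgt :: "'g \<Rightarrow> 'a \<Rightarrow> bool" where
  "vgt g x \<longleftrightarrow> x = 0 \<or> g < v x"

lemma v_mult: "x \<noteq> 0 \<Longrightarrow> y \<noteq> 0 \<Longrightarrow> v (x * y) = v x + v y"
  using valuation unfolding valuation_def by blast

lemma v_add: "x \<noteq> 0 \<Longrightarrow> y \<noteq> 0 \<Longrightarrow> x + y \<noteq> 0 \<Longrightarrow> min (v x) (v y) \<le> v (x + y)"
  using valuation unfolding valuation_def by blast

lemma v_one [simp]: "v 1 = 0"
  using v_mult[of 1 1] by simp

lemma v_neg_one: "v (-1) = 0"
  using v_mult[of "-1" "-1"] by simp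

lemma v_minus [simp]: "v (- x) = v x"
  using v_mult[of "-1" x] v_neg_one by (cases "x = 0") simp_all

lemma v_divide: "x \<noteq> 0 \<Longrightarrow> y \<noteq> 0 \<Longrightarrow> v (x / y) = v x - v y"
  using v_mult[of "x / y" y] by (simp add: eq_diff_eq)

lemma vge_zero [simp]: "vge g 0" and vgt_zero [simp]: "vgt g 0"
  by (simp_all add: vge_def vgt_def)

lemma vge_minus [simp]: "vge g (- x) \<longleftrightarrow> vge g x"
  and vgt_minus [simp]: "vgt g (- x) \<longleftrightarrow> vgt g x"
  by (simp_all add: vge_def vgt_def)

lemma vge_add: "vge g x \<Longrightarrow> vge g y \<Longrightarrow> vge g (x + y)"
  unfolding vge_def using v_add[of x y] by (fastforce simp: min_le_iff_disj)

lemma vgt_add: "vgt g x \<Longrightarrow> vgt g y \<Longrightarrow> vgt g (x + y)"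
  unfolding vgt_def using v_add[of x y] by (fastforce simp: min_le_iff_disj)

lemma vge_diff: "vge g x \<Longrightarrow> vge g y \<Longrightarrow> vge g (x - y)"
  using vge_add[of g x "- y"] by simp

lemma vgt_diff: "vgt g x \<Longrightarrow> vgt g y \<Longrightarrow> vgt g (x - y)"
  using vgt_add[of g x "- y"] by simp

lemma vge_sum: "(\<And>i. i \<in> A \<Longrightarrow> vge g (t i)) \<Longrightarrow> vge g (sum t A)"
  by (induction A rule: infinite_finite_induct) (auto intro: vge_add)

lemma vgt_sum: "(\<And>i. i \<in> A \<Longrightarrow> vgt g (t i)) \<Longrightarrow> vgt g (sum t A)"
  by (induction A rule: infinite_finite_induct) (auto intro: vgt_add)

lemma v_le_mult: "x \<noteq> 0 \<Longrightarrow> y \<noteq> 0 \<Longrightarrow> vge 0 y \<Longrightarrow> v x \<le> v (x * y)"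
  by (simp add: vge_def v_mult)

lemma vge_mult: "vge g x \<Longrightarrow> vge 0 y \<Longrightarrow> vge g (x * y)"
  using v_le_mult[of x y] by (auto simp: vge_def[of g] intro: order_trans)

lemma vgt_mult: "vgt g x \<Longrightarrow> vge 0 y \<Longrightarrow> vgt g (x * y)"
  using v_le_mult[of x y] by (auto simp: vgt_def intro: less_le_trans)

lemma vge_divide: "c \<noteq> 0 \<Longrightarrow> vge 0 (x / c) \<longleftrightarrow> vge (v c) x"
  and vgt_divide: "c \<noteq> 0 \<Longrightarrow> vgt 0 (x / c) \<longleftrightarrow> vgt (v c) x"
  by (cases "x = 0"; simp add: vge_def vgt_def v_divide)+

lemma vge_of_nat: "vge 0 (of_nat m)"
  by (induction m) (auto intro: vge_add simp: vge_def[of 0 1])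

lemma vge_of_int: "vge 0 (of_int z)"
  by (cases z) (auto simp: vge_of_nat simp del: of_nat_Suc intro!: vge_diff vge_of_nat simp: vge_def[of 0 1])

text \<open>By Bezout, \<open>z\<close> has an integer inverse modulo the characteristic. Both
  factors have nonnegative value and the values add up to 0, so both vanish.\<close>

lemma v_of_int_eq_0:
  assumes "prime CHAR('a)" and "\<not> int CHAR('a) dvd z"
  shows "of_int z \<noteq> (0::'a)" and "v (of_int z) = 0"
proof -
  have "coprime z (int CHAR('a))"
    using assms prime_imp_coprime[of "int CHAR('a)" z] by (simp add: coprime_commute)
  then obtain a b where "a * z + b * int CHAR('a) = 1"
    using bezout_int[of z "int CHAR('a)"] by auto
  from arg_cong[OF this, of "of_int :: int \<Rightarrow> 'a"]
  have *: "of_int a * of_int z = (1::'a)" by simp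
  then show nz: "of_int z \<noteq> (0::'a)" by auto
  have nz': "of_int a \<noteq> (0::'a)" using * by auto
  have "v (of_int a) + v (of_int z) = 0"
    using v_mult[OF nz' nz] * by simp
  with vge_of_int[of a] vge_of_int[of z] nz nz' show "v (of_int z) = 0"
    by (simp add: vge_def add_nonneg_eq_0_iff)
qed

text \<open>A strictly smallest term cannot be cancelled: otherwise subtracting the remaining terms
  would give \<open>t u\<close> a value above its own.\<close>

lemma sum_unique_min:
  assumes "finite A" "u \<in> A" "t u \<noteq> 0" "\<And>i. i \<in> A - {u} \<Longrightarrow> vgt (v (t u)) (t i)"
  shows "\<not> vgt (v (t u)) (sum t A)"
proof
  assume "vgt (v (t u)) (sum t A)"
  moreover have "vgt (v (t u)) (sum t (A - {u}))"
    using assms(4) by (rule vgt_sum)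
  ultimately have "vgt (v (t u)) (sum t A - sum t (A - {u}))"
    by (rule vgt_diff)
  then show False
    using assms by (simp add: sum.remove vgt_def)
qed

lemma v_power_less:
  assumes "x \<noteq> 0" "y \<noteq> 0" "v x < v y" "d > 0"
  shows "v (x ^ d) < v (y ^ d)"
  using assms(4)
proof (induction d rule: nat_induct_non_zero)
  case (Suc d)
  then show ?case using assms by (simp add: v_mult add_strict_mono)
qed (use assms in simp)

text \<open>As a function of \<open>v x\<close>, the value of a monomial of larger degree has larger slope.\<close>

lemma monomials_cross:
  assumes "x \<noteq> 0" "y \<noteq> 0" "v x < v y" "m < n" "c \<noteq> 0" "d \<noteq> 0"
    and "v (c * x ^ m) \<le> v (d * x ^ n)"
  shows "v (c * y ^ m) < v (d * y ^ n)"
proof -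
  obtain e where e: "n = m + e" "e > 0"
    using less_imp_add_positive[OF assms(4)] by auto
  have "v c \<le> v d + v (x ^ e)"
    using assms e by (simp add: v_mult power_add algebra_simps)
  also have "\<dots> < v d + v (y ^ e)"
    using v_power_less[OF assms(1-3) e(2)] by simp
  finally show ?thesis
    using assms e by (simp add: v_mult power_add algebra_simps)
qed

section \<open>Ties in the Newton polygon\<close>

text \<open>
  If \<open>y\<close> is a root of \<open>F\<close>, this is the left end of the edge of slope \<open>- v y\<close> of the Newton
  polygon of \<open>F\<close>.
\<close>

definition pivot :: "'a poly \<Rightarrow> 'a \<Rightarrow> nat" where
  "pivot F y = (LEAST j. coeff F j \<noteq> 0 \<and>
     (\<forall>i. coeff F i \<noteq> 0 \<longrightarrow> v (coeff F j * y ^ j) \<le> v (coeff F i * y ^ i)))"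

context
  fixes F :: "'a poly" and y :: 'a
  assumes F: "F \<noteq> 0" and y: "y \<noteq> 0"
begin

lemma pivot_minimal:
  shows coeff_pivot: "coeff F (pivot F y) \<noteq> 0"
    and pivot_le: "coeff F i \<noteq> 0 \<Longrightarrow>
      v (coeff F (pivot F y) * y ^ pivot F y) \<le> v (coeff F i * y ^ i)"
proof -
  let ?A = "{j. coeff F j \<noteq> 0}" and ?g = "\<lambda>j. v (coeff F j * y ^ j)"
  have "finite ?A"
    by (rule finite_subset[of _ "{..degree F}"]) (auto intro: le_degree)
  moreover have "?A \<noteq> {}"
    using F by (auto simp: poly_eq_iff)
  ultimately obtain j where "j \<in> ?A" "\<And>i. i \<in> ?A \<Longrightarrow> ?g j \<le> ?g i"
    using ex_min_if_finite[of "?g ` ?A"] by (fastforce simp: not_less)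
  then have "\<exists>j. coeff F j \<noteq> 0 \<and> (\<forall>i. coeff F i \<noteq> 0 \<longrightarrow> ?g j \<le> ?g i)"
    by blast
  from LeastI_ex[OF this] show "coeff F (pivot F y) \<noteq> 0"
    "coeff F i \<noteq> 0 \<Longrightarrow> ?g (pivot F y) \<le> ?g i"
    unfolding pivot_def by blast+
qed

lemma pivot_less:
  assumes "i < pivot F y" "coeff F i \<noteq> 0"
  shows "v (coeff F (pivot F y) * y ^ pivot F y) < v (coeff F i * y ^ i)"
proof (rule ccontr)
  assume "\<not> ?thesis"
  then have "\<forall>l. coeff F l \<noteq> 0 \<longrightarrow> v (coeff F i * y ^ i) \<le> v (coeff F l * y ^ l)"
    using pivot_le by (auto intro: order_trans simp: not_less)
  then show False
    using assms not_less_Least unfolding pivot_def by blast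
qed

text \<open>Without a tie, the pivot term would be the only one of minimal value, since earlier
  terms are strictly larger by leastness; the terms could not then sum to 0.\<close>

lemma pivot_tie:
  assumes "poly F y = 0"
  shows "\<exists>j>pivot F y. coeff F j \<noteq> 0 \<and>
    v (coeff F j * y ^ j) = v (coeff F (pivot F y) * y ^ pivot F y)"
proof (rule ccontr)
  assume no: "\<not> ?thesis"
  let ?u = "pivot F y" and ?t = "\<lambda>j. coeff F j * y ^ j"
  have "\<not> vgt (v (?t ?u)) (sum ?t {..degree F})"
  proof (rule sum_unique_min)
    show "?u \<in> {..degree F}"
      using coeff_pivot by (auto intro: le_degree)
    show "?t ?u \<noteq> 0"
      using coeff_pivot y by simp
    fix i
    assume i: "i \<in> {..degree F} - {?u}"
    show "vgt (v (?t ?u)) (?t i)"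
    proof (cases "coeff F i = 0")
      case False
      have "v (?t ?u) < v (?t i)"
      proof (cases "i < ?u")
        case True
        then show ?thesis using False by (rule pivot_less)
      next
        case nlt: False
        then have "v (?t i) \<noteq> v (?t ?u)"
          using no i False by (metis DiffD2 insertI1 linorder_neqE_nat)
        with pivot_le[OF False] show ?thesis by simp
      qed
      then show ?thesis by (simp add: vgt_def)
    qed simp
  qed simp
  with assms show False
    by (simp add: poly_altdef)
qed

text \<open>Cancelling \<open>y ^ i\<close> in the strict inequality at \<open>i\<close> leaves a
  positive power of \<open>y\<close> beside the pivot coefficient, which only strengthens the
  inequality.\<close>

lemma coeff_below_pivot:
  assumes "0 < v y" "i < pivot F y"
  shows "vgt (v (coeff F (pivot F y))) (coeff F i)"
proof (cases "coeff F i = 0")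
  case False
  obtain d where d: "d > 0" "i + d = pivot F y"
    using less_imp_add_positive[OF assms(2)] by blast
  have "v (y ^ pivot F y) = v (y ^ i) + v (y ^ d)"
    using y by (simp add: d(2)[symmetric] power_add v_mult)
  then have "(v (coeff F (pivot F y)) + v (y ^ d)) + v (y ^ i) < v (coeff F i) + v (y ^ i)"
    using pivot_less[OF assms(2) False] y False coeff_pivot by (simp add: v_mult add_ac)
  then have "v (coeff F (pivot F y)) + v (y ^ d) < v (coeff F i)"
    by (simp only: add_less_cancel_right)
  moreover have "0 < v (y ^ d)"
    using v_power_less[of 1 y d] assms y d by simp
  then have "v (coeff F (pivot F y)) < v (coeff F (pivot F y)) + v (y ^ d)"
    by simp
  ultimately have "v (coeff F (pivot F y)) < v (coeff F i)"
    by (rule less_trans[rotated])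
  then show ?thesis by (simp add: vgt_def)
qed simp

text \<open>The pivot coefficient has the value of a tied later coefficient times a positive power
  of \<open>y\<close>, hence a strictly larger value than that coefficient.\<close>

lemma coeff_pivot_not_minimal:
  assumes "poly F y = 0" "0 < v y" "\<And>j. vge g (coeff F j)"
  shows "vgt g (coeff F (pivot F y))"
proof -
  obtain j where j: "j > pivot F y" "coeff F j \<noteq> 0"
    "v (coeff F j * y ^ j) = v (coeff F (pivot F y) * y ^ pivot F y)"
    using pivot_tie[OF assms(1)] by blast
  obtain d where d: "d > 0" "pivot F y + d = j"
    using less_imp_add_positive[OF j(1)] by blast
  have "g \<le> v (coeff F j)"
    using assms(3)[of j] j by (simp add: vge_def)
  also have "0 < v (y ^ d)"
    using v_power_less[of 1 y d] assms y d by simp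
  then have "v (coeff F j) < v (coeff F j) + v (y ^ d)"
    by simp
  also have "v (y ^ j) = v (y ^ pivot F y) + v (y ^ d)"
    using y by (simp add: d(2)[symmetric] power_add v_mult)
  then have "v (coeff F j) + v (y ^ d) = v (coeff F (pivot F y))"
    using j(2,3) y coeff_pivot by (simp add: v_mult algebra_simps)
  finally show ?thesis by (simp add: vgt_def)
qed

end

text \<open>A common pivot would be minimal at \<open>x\<close>; raising the value to
  \<open>v y\<close> makes every later monomial strictly larger than it, which contradicts the tie
  at \<open>y\<close>. Only \<open>y\<close> has to be a root.\<close>

lemma pivot_cross:
  assumes "F \<noteq> 0" "x \<noteq> 0" "y \<noteq> 0" "poly F y = 0" "v x < v y"
  shows "pivot F x \<noteq> pivot F y"
proof
  assume eq: "pivot F x = pivot F y"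
  obtain j where j: "j > pivot F y" "coeff F j \<noteq> 0"
    "v (coeff F j * y ^ j) = v (coeff F (pivot F y) * y ^ pivot F y)"
    using pivot_tie assms by blast
  have "v (coeff F (pivot F y) * x ^ pivot F y) \<le> v (coeff F j * x ^ j)"
    using pivot_le[of F x j] assms j eq by simp
  then have "v (coeff F (pivot F y) * y ^ pivot F y) < v (coeff F j * y ^ j)"
    by (rule monomials_cross[OF assms(2,3,5) j(1) coeff_pivot[OF assms(1,3)] j(2)])
  with j show False by simp
qed

lemma pivot_eq_iff:
  assumes "F \<noteq> 0" "x \<noteq> 0" "y \<noteq> 0" "poly F x = 0" "poly F y = 0" "pivot F x = pivot F y"
  shows "v x = v y"
  using pivot_cross assms by (metis linorder_cases)

section \<open>Counting by distances\<close>

text \<open>The map \<open>(x - a) / c\<close> carries \<open>S\<close> into the valuation ring and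
  its points into distinct residue classes.\<close>

lemma card_separated_le:
  assumes fin: "finite (residue_field v)" and c: "c \<noteq> 0"
    and ge: "\<And>x. x \<in> S \<Longrightarrow> vge (v c) (x - a)"
    and sep: "\<And>x y. x \<in> S \<Longrightarrow> y \<in> S \<Longrightarrow> vgt (v c) (x - y) \<Longrightarrow> x = y"
  shows "card S \<le> card (residue_field v)"
proof (rule card_inj_on_le[OF _ _ fin])
  define R where "R = {(x, y) \<in> valuation_ring v \<times> valuation_ring v. x - y \<in> valuation_ideal v}"
  let ?h = "\<lambda>x. (x - a) / c"
  have ring: "?h x \<in> valuation_ring v" if "x \<in> S" for x
    using vge_divide[OF c, of "x - a"] ge[OF that] by (simp add: valuation_ring_def vge_def)
  show "(\<lambda>x. R `` {?h x}) ` S \<subseteq> residue_field v"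
    using ring unfolding residue_field_def R_def[symmetric] by (auto intro: quotientI)
  show "inj_on (\<lambda>x. R `` {?h x}) S"
  proof (rule inj_onI)
    fix x y
    assume xy: "x \<in> S" "y \<in> S" "R `` {?h x} = R `` {?h y}"
    have "?h y \<in> R `` {?h y}"
      using ring[OF xy(2)] by (simp add: R_def valuation_ideal_def)
    with xy(3) have "?h x - ?h y \<in> valuation_ideal v"
      by (auto simp: R_def)
    then have "vgt 0 ((x - y) / c)"
      by (simp add: valuation_ideal_def vgt_def diff_divide_distrib)
    then show "x = y"
      using sep xy vgt_divide[OF c] by blast
  qed
qed

text \<open>The relation \<open>vgt g (x - y)\<close> is an equivalence; \<open>S\<close> takes one
  point from each of its classes in \<open>Z\<close>.\<close>

lemma ex_separated:
  assumes "finite Z" and B: "\<And>x. x \<in> Z \<Longrightarrow> card {y \<in> Z. vgt g (x - y)} \<le> B"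
  shows "\<exists>S\<subseteq>Z. card Z \<le> card S * B \<and> (\<forall>x\<in>S. \<forall>y\<in>S. vgt g (x - y) \<longrightarrow> x = y)"
proof -
  let ?c = "\<lambda>x. {y \<in> Z. vgt g (x - y)}"
  obtain S where S: "S \<subseteq> Z" "inj_on ?c S" "?c ` Z = ?c ` S"
    using subset_image_inj[of "?c ` Z" ?c Z] by auto
  have cong: "?c x = ?c y" if "vgt g (x - y)" for x y
  proof -
    have "vgt g (x - z) \<longleftrightarrow> vgt g (y - z)" for z
      using vgt_diff[of g "x - z" "x - y"] vgt_add[of g "x - y" "y - z"] that by auto
    then show ?thesis by simp
  qed
  have "\<Union> (?c ` Z) = Z"
    by force
  then have "card Z = card (\<Union> (?c ` S))"
    by (simp only: S(3))
  also have "\<dots> \<le> (\<Sum>x\<in>S. card (?c x))"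
    using finite_subset[OF S(1) assms(1)] by (rule card_UN_le)
  also have "\<dots> \<le> card S * B"
    using sum_bounded_above[of S "\<lambda>x. card (?c x)" B] B S(1) by auto
  finally have "card Z \<le> card S * B" .
  moreover have "x = y" if "x \<in> S" "y \<in> S" "vgt g (x - y)" for x y
    using inj_onD[OF S(2) cong[OF that(3)] that(1,2)] .
  ultimately show ?thesis
    using S(1) by blast
qed

text \<open>Induction on \<open>d\<close>: the least value of a difference splits \<open>Z\<close>
  into at most \<open>q\<close> classes, and within a class each point no longer sees that
  value.\<close>

lemma card_le_by_distances:
  assumes fin: "finite (residue_field v)" and "finite Z"
    and "\<And>x. x \<in> Z \<Longrightarrow> card ((\<lambda>y. v (y - x)) ` (Z - {x})) \<le> d"
  shows "card Z \<le> card (residue_field v) ^ d"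
  using assms(2,3)
proof (induction d arbitrary: Z)
  case 0
  have "x = y" if "x \<in> Z" "y \<in> Z" for x y
    using 0(2)[of x] 0(1) that by auto
  then have "card Z \<le> 1"
    using card_le_Suc0_iff_eq[OF 0(1)] by auto
  then show ?case by simp
next
  case (Suc d)
  let ?D = "(\<lambda>(x, y). v (y - x)) ` {(x, y). x \<in> Z \<and> y \<in> Z \<and> x \<noteq> y}"
  show ?case
  proof (cases "?D = {}")
    case True
    then have "card Z \<le> 1"
      using card_le_Suc0_iff_eq[OF Suc.prems(1)] by auto
    moreover have "card (residue_field v) \<noteq> 0"
      using card_separated_le[OF fin, of 1 "{0}" 0] by auto
    then have "1 \<le> card (residue_field v) ^ Suc d"
      using one_le_power[of "card (residue_field v)" "Suc d"] by linarith
    ultimately show ?thesis by linarith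
  next
    case False
    have "finite ?D"
      by (rule finite_imageI, rule finite_subset[of _ "Z \<times> Z"]) (use Suc.prems in auto)
    from Min_in[OF this False] obtain a b where ab: "a \<in> Z" "b \<in> Z" "a \<noteq> b"
      and Min: "Min ?D = v (b - a)"
      by auto
    have le: "vge (v (b - a)) (y - x)" if "x \<in> Z" "y \<in> Z" for x y
    proof (cases "x = y")
      case False
      with that have "v (y - x) \<in> ?D" by force
      from Min_le[OF \<open>finite ?D\<close> this] show ?thesis
        unfolding Min vge_def by simp
    qed simp
    let ?g = "v (b - a)"
    have "card {y \<in> Z. vgt ?g (x - y)} \<le> card (residue_field v) ^ d" if x: "x \<in> Z" for x
    proof (rule Suc.IH)
      let ?C = "{y \<in> Z. vgt ?g (x - y)}"
      show "finite ?C" using Suc.prems by simp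
      fix z
      assume z: "z \<in> ?C"
      \<comment> \<open>Every point sees the least value: if \<open>z\<close> were closer than that
        to both \<open>a\<close> and \<open>b\<close>, then \<open>a\<close> and \<open>b\<close>
        would be too close to each other.\<close>
      have "\<exists>w\<in>Z - {z}. v (w - z) = ?g"
      proof (rule ccontr)
        assume "\<not> ?thesis"
        then have "vgt ?g (w - z)" if "w \<in> Z" for w
          using le[of z w] that z by (force simp: vge_def vgt_def)
        from vgt_diff[OF this[OF ab(2)] this[OF ab(1)]] have "vgt ?g (b - a)"
          by simp
        then show False using ab by (simp add: vgt_def)
      qed
      then have g: "?g \<in> (\<lambda>y. v (y - z)) ` (Z - {z})" by force
      have "vgt ?g (w - z)" if "w \<in> ?C" for w
        using vgt_diff[of ?g "x - z" "x - w"] z that by auto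
      then have "(\<lambda>y. v (y - z)) ` (?C - {z}) \<subseteq> (\<lambda>y. v (y - z)) ` (Z - {z}) - {?g}"
        by (force simp: vgt_def)
      then have "card ((\<lambda>y. v (y - z)) ` (?C - {z})) \<le> card ((\<lambda>y. v (y - z)) ` (Z - {z}) - {?g})"
        using Suc.prems by (intro card_mono) auto
      also have "\<dots> = card ((\<lambda>y. v (y - z)) ` (Z - {z})) - 1"
        using g by simp
      also have "\<dots> \<le> d"
        using Suc.prems(2)[of z] z by simp
      finally show "card ((\<lambda>y. v (y - z)) ` (?C - {z})) \<le> d" .
    qed
    from ex_separated[OF Suc.prems(1) this] obtain S
      where S: "S \<subseteq> Z" "card Z \<le> card S * card (residue_field v) ^ d"
        "\<And>x y. x \<in> S \<Longrightarrow> y \<in> S \<Longrightarrow> vgt ?g (x - y) \<Longrightarrow> x = y"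
      by blast
    have "card S \<le> card (residue_field v)"
      by (rule card_separated_le[OF fin, of "b - a" _ a]) (use S ab le in auto)
    with S(2) show ?thesis
      by (metis le_trans mult_le_mono1 power_Suc)
  qed
qed

end

section \<open>Counting lemmas\<close>

text \<open>Linear algebra modulo \<open>p\<close> by pigeonhole: independence makes the map from
  coefficient vectors to row values injective, so
  \<open>p ^ card U \<le> p ^ card N\<close>.\<close>

lemma card_le_if_columns_independent:
  fixes M :: "'b \<Rightarrow> 'c \<Rightarrow> int" and p :: nat
  assumes "finite U" "finite N" "p > 1"
    and indep: "\<And>w. (\<And>i. i \<in> N \<Longrightarrow> int p dvd (\<Sum>u\<in>U. w u * M i u)) \<Longrightarrow> (\<And>u. u \<in> U \<Longrightarrow> int p dvd w u)"
  shows "card U \<le> card N"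
proof -
  let ?P = "{0..<int p}"
  let ?h = "\<lambda>w. \<lambda>i\<in>N. (\<Sum>u\<in>U. w u * M i u) mod int p"
  have "inj_on ?h (U \<rightarrow>\<^sub>E ?P)"
  proof (rule inj_onI)
    fix w w'
    assume w: "w \<in> U \<rightarrow>\<^sub>E ?P" and w': "w' \<in> U \<rightarrow>\<^sub>E ?P" and eq: "?h w = ?h w'"
    have "int p dvd (\<Sum>u\<in>U. (w u - w' u) * M i u)" if "i \<in> N" for i
      using fun_cong[OF eq, of i] that
      by (simp add: left_diff_distrib sum_subtractf mod_eq_dvd_iff)
    then have dvd: "int p dvd w u - w' u" if "u \<in> U" for u
      using indep[of "\<lambda>u. w u - w' u"] that by blast
    have "w u = w' u" if "u \<in> U" for u
    proof -
      have "w u mod int p = w' u mod int p"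
        using dvd[OF that] by (simp add: mod_eq_dvd_iff)
      moreover have "w u \<in> ?P" "w' u \<in> ?P"
        using w w' that by (auto dest: PiE_mem)
      ultimately show ?thesis by simp
    qed
    then show "w = w'"
      using w w' by (rule PiE_ext[rotated 2])
  qed
  moreover have "?h ` (U \<rightarrow>\<^sub>E ?P) \<subseteq> N \<rightarrow>\<^sub>E ?P"
    using assms(3) by auto
  moreover have "finite (N \<rightarrow>\<^sub>E ?P)"
    using assms(2) by (auto intro: finite_PiE)
  ultimately have "card (U \<rightarrow>\<^sub>E ?P) \<le> card (N \<rightarrow>\<^sub>E ?P)"
    by (rule card_inj_on_le)
  then have "p ^ card U \<le> p ^ card N"
    using assms by (simp add: card_funcsetE)
  then show ?thesis
    using assms(3) by simp
qed

text \<open>The hypothesis bounds the \<open>j\<close>-th largest exponent by \<open>k - j\<close>,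
  so the sum is at most a geometric one. The induction removes an element with the largest exponent,
  which is counted in every set \<open>{h \<in> \<Gamma>. d g \<le> d h}\<close>.\<close>

lemma sum_power_less:
  fixes d :: "'b \<Rightarrow> nat" and q :: nat
  assumes "finite \<Gamma>" and "\<And>g. g \<in> \<Gamma> \<Longrightarrow> card {h \<in> \<Gamma>. d g \<le> d h} + d g \<le> k" and "q > 0"
  shows "(q - 1) * (\<Sum>g\<in>\<Gamma>. q ^ d g) < q ^ k"
  using assms(1,2)
proof (induction k arbitrary: \<Gamma>)
  case 0
  have "\<Gamma> = {}"
  proof (rule ccontr)
    assume "\<Gamma> \<noteq> {}"
    then obtain g where "g \<in> \<Gamma>" by blast
    moreover from this 0 have "card {h \<in> \<Gamma>. d g \<le> d h} = 0" by fastforce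
    ultimately show False using 0 by auto
  qed
  then show ?case by simp
next
  case (Suc k)
  show ?case
  proof (cases "\<Gamma> = {}")
    case False
    have "finite (d ` \<Gamma>)" "d ` \<Gamma> \<noteq> {}" using Suc.prems False by auto
    from Max_in[OF this] obtain m where "m \<in> \<Gamma>" and Max: "Max (d ` \<Gamma>) = d m"
      by auto
    have m: "m \<in> \<Gamma>" "\<And>g. g \<in> \<Gamma> \<Longrightarrow> d g \<le> d m"
      using \<open>m \<in> \<Gamma>\<close> Max_ge[OF \<open>finite (d ` \<Gamma>)\<close>] unfolding Max by auto
    have le: "card {h \<in> \<Gamma> - {m}. d g \<le> d h} + d g \<le> k" if "g \<in> \<Gamma>" for g
    proof -
      have "{h \<in> \<Gamma>. d g \<le> d h} = insert m {h \<in> \<Gamma> - {m}. d g \<le> d h}"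
        using m that by auto
      then have "card {h \<in> \<Gamma>. d g \<le> d h} = Suc (card {h \<in> \<Gamma> - {m}. d g \<le> d h})"
        using Suc.prems(1) by simp
      with Suc.prems(2)[OF that] show ?thesis by simp
    qed
    have "(q - 1) * (\<Sum>g\<in>\<Gamma>. q ^ d g) = (q - 1) * q ^ d m + (q - 1) * (\<Sum>g\<in>\<Gamma> - {m}. q ^ d g)"
      by (simp add: sum.remove[OF Suc.prems(1) m(1)] distrib_left)
    also have "\<dots> < (q - 1) * q ^ k + q ^ k"
    proof (rule add_le_less_mono)
      show "(q - 1) * q ^ d m \<le> (q - 1) * q ^ k"
        using le[OF m(1)] assms(3) by (intro mult_le_mono2 power_increasing) auto
      show "(q - 1) * (\<Sum>g\<in>\<Gamma> - {m}. q ^ d g) < q ^ k"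
        using Suc.prems(1) le by (intro Suc.IH) auto
    qed
    also have "\<dots> = q ^ Suc k"
      using assms(3) by (cases q) simp_all
    finally show ?thesis .
  qed (use assms(3) in simp)
qed

section \<open>Sparse polynomials\<close>

locale sparse_polynomial = valued_field v
  for v :: "'a::field \<Rightarrow> 'g::linordered_ab_group_add" +
  fixes k :: nat and a :: "nat \<Rightarrow> 'a" and n :: "nat \<Rightarrow> nat"
  assumes prime_char: "prime CHAR('a)"
    and inj_n: "inj_on n {..k}"
    and a_nonzero: "i \<le> k \<Longrightarrow> a i \<noteq> 0"
begin

definition f :: "'a poly" where
  "f = (\<Sum>i\<le>k. monom (a i) (n i))"

definition summand :: "'a \<Rightarrow> nat \<Rightarrow> 'a" where
  "summand x i = a i * x ^ n i"

definition shifted :: "'a \<Rightarrow> 'a poly" where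
  "shifted x = f \<circ>\<^sub>p [:x, x:]"

lemma poly_f: "poly f x = (\<Sum>i\<le>k. summand x i)"
  by (simp add: f_def poly_sum poly_monom summand_def)

lemma f_nonzero: "f \<noteq> 0"
proof -
  have "coeff f (n 0) = (\<Sum>i\<le>k. if i = 0 then a 0 else 0)"
    unfolding f_def coeff_sum using inj_n by (intro sum.cong) (auto dest: inj_onD)
  then show ?thesis using a_nonzero[of 0] by auto
qed

lemma finite_roots: "finite {x. poly f x = 0}"
  using f_nonzero by (rule poly_roots_finite)

lemma summand_nonzero: "x \<noteq> 0 \<Longrightarrow> i \<le> k \<Longrightarrow> summand x i \<noteq> 0"
  by (simp add: summand_def a_nonzero)

lemma poly_shifted: "poly (shifted x) y = poly f (x + x * y)"
  by (simp add: shifted_def poly_pcompose algebra_simps)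

lemma shifted_nonzero: "x \<noteq> 0 \<Longrightarrow> shifted x \<noteq> 0"
  by (simp add: shifted_def f_nonzero pcompose_eq_0_iff)

text \<open>Binomial expansion of \<open>(x + x * y) ^ n i\<close>. The cast through
  \<open>int\<close> lets integer combinations of columns be tested for divisibility by the
  characteristic.\<close>

lemma coeff_shifted:
  "coeff (shifted x) j = (\<Sum>i\<le>k. summand x i * of_int (int (n i choose j)))"
proof -
  have "monom c m \<circ>\<^sub>p r = smult c (r ^ m)" for c :: 'a and m r
    by (induction m) (simp_all add: monom_0 monom_Suc pcompose_pCons)
  moreover have "[:x, x:] ^ m = smult (x ^ m) ([:1, 1:] ^ m)" for m
    by (simp flip: smult_power)
  moreover have "coeff ([:1, 1:] ^ m) j = (of_nat (m choose j) :: 'a)" for m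
  proof (cases "j \<le> m")
    case True
    then show ?thesis by (simp add: coeff_linear_poly_power)
  next
    case False
    then show ?thesis by (simp add: coeff_eq_0 degree_linear_power binomial_eq_0)
  qed
  ultimately show ?thesis
    by (simp add: shifted_def f_def pcompose_sum coeff_sum summand_def)
qed

section \<open>Right ends of the edges of the Newton polygon of \<open>f\<close>\<close>

definition leading_at :: "'a \<Rightarrow> nat \<Rightarrow> bool" where
  "leading_at x t \<longleftrightarrow> t \<le> k \<and> (\<forall>i\<le>k. v (summand x t) \<le> v (summand x i) \<and>
     (n t < n i \<longrightarrow> v (summand x t) < v (summand x i)))"

text \<open>At a root \<open>x\<close>, the right end of the edge of slope \<open>- v x\<close>.
  Ties are broken by exponent because \<open>n\<close> need not be increasing.\<close>

definition leading :: "'a \<Rightarrow> nat" where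
  "leading x = (SOME t. leading_at x t)"

lemma leading_at: "leading_at x (leading x)"
proof -
  let ?g = "\<lambda>i. v (summand x i)"
  let ?m = "Min (?g ` {..k})"
  let ?T = "{i. i \<le> k \<and> ?g i = ?m}"
  have "?m \<in> ?g ` {..k}" by (intro Min_in) auto
  then obtain i where "?m = ?g i" "i \<in> {..k}" by (rule imageE)
  then have "i \<in> ?T" by simp
  then have "n ` ?T \<noteq> {}" by blast
  then have "Max (n ` ?T) \<in> n ` ?T" by (intro Max_in) auto
  then obtain t where t: "t \<in> ?T" "n t = Max (n ` ?T)" by auto
  have min: "?m \<le> ?g i" if "i \<le> k" for i
    using that by (intro Min_le) auto
  have "?m < ?g i" if "i \<le> k" "n t < n i" for i
  proof -
    have "i \<notin> ?T"
    proof
      assume "i \<in> ?T"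
      then have "n i \<le> Max (n ` ?T)" by (intro Max_ge) auto
      with that t show False by simp
    qed
    with min[of i] that show ?thesis by (auto simp: less_le)
  qed
  with t min have "leading_at x t"
    unfolding leading_at_def by auto
  then show ?thesis unfolding leading_def by (rule someI)
qed

lemma leading_le: "leading x \<le> k"
  and summand_leading_le: "i \<le> k \<Longrightarrow> v (summand x (leading x)) \<le> v (summand x i)"
  and summand_leading_less:
    "i \<le> k \<Longrightarrow> n (leading x) < n i \<Longrightarrow> v (summand x (leading x)) < v (summand x i)"
  using leading_at[of x] by (auto simp: leading_at_def)

abbreviation level :: "'a \<Rightarrow> 'g" where
  "level x \<equiv> v (summand x (leading x))"

lemma leading_tie:
  assumes "x \<noteq> 0" "poly f x = 0"
  shows "\<exists>s\<le>k. n s < n (leading x) \<and> v (summand x s) = level x"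
proof (rule ccontr)
  assume no: "\<not> ?thesis"
  have "\<not> vgt (level x) (\<Sum>i\<le>k. summand x i)"
  proof (rule sum_unique_min)
    fix i
    assume i: "i \<in> {..k} - {leading x}"
    then have "n i \<noteq> n (leading x)"
      using inj_n leading_le by (auto dest: inj_onD)
    then have "level x < v (summand x i)"
      using no i summand_leading_le[of i x] summand_leading_less[of i x]
      by (cases "n i < n (leading x)") (auto simp: less_le)
    then show "vgt (level x) (summand x i)" by (simp add: vgt_def)
  qed (use leading_le summand_nonzero assms in auto)
  with assms show False by (simp add: poly_f)
qed

text \<open>At \<open>x\<close> a smaller exponent ties with the leading one; at the larger value
  \<open>v y\<close> it wins strictly, so \<open>leading x\<close> is not minimal there.\<close>

lemma leading_distinct:
  assumes "x \<noteq> 0" "poly f x = 0" "y \<noteq> 0" "v x < v y"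
  shows "leading x \<noteq> leading y"
proof
  assume eq: "leading x = leading y"
  obtain s where s: "s \<le> k" "n s < n (leading x)" "v (summand x s) = level x"
    using leading_tie assms by blast
  have "v (summand y s) < v (summand y (leading x))"
    using monomials_cross[OF assms(1,3,4) s(2), of "a s" "a (leading x)"] s a_nonzero leading_le[of x]
    by (simp add: summand_def)
  with summand_leading_le[OF s(1), of y] eq show False by simp
qed

section \<open>Rows and columns of the binomial matrix modulo the characteristic\<close>

lemma coeff_shifted_level: "x \<noteq> 0 \<Longrightarrow> vge (level x) (coeff (shifted x) j)"
  unfolding coeff_shifted
  by (intro vge_sum vge_mult vge_of_int) (simp add: vge_def summand_leading_le)

text \<open>The elements \<open>y\<close> of \<open>near x\<close> correspond to the other roots \<open>x (1 + y)\<close> in the coset \<open>x (1 + \<M>)\<close>.\<close>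

definition near :: "'a \<Rightarrow> 'a set" where
  "near x = {y. y \<noteq> 0 \<and> poly (shifted x) y = 0 \<and> 0 < v y}"

text \<open>The additional column 0 offsets the matrix having \<open>k + 1\<close> rows, so that
  \<open>card_values_le\<close> ends with \<open>k\<close>.\<close>

definition pivots :: "'a \<Rightarrow> nat set" where
  "pivots x = insert 0 (pivot (shifted x) ` near x)"

text \<open>One combination of columns, read row by row on the left and through the coefficients of
  \<open>shifted x\<close> on the right.\<close>

lemma combination_eq:
  "(\<Sum>i\<le>k. summand x i * of_int (\<Sum>u\<in>U. w u * int (n i choose u))) =
   (\<Sum>u\<in>U. of_int (w u) * coeff (shifted x) u)"
  by (simp only: coeff_shifted of_int_sum of_int_mult sum_distrib_left mult_ac)
     (rule sum.swap)

text \<open>The whole combination has value above \<open>level x\<close>. Earlier rows contribute 0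
  and later ones have larger value, so an entry prime to the characteristic in the leading row would
  be an uncancelled minimum.\<close>

lemma dvd_leading_row:
  assumes x: "x \<noteq> 0"
    and U: "\<And>u. u \<in> U \<Longrightarrow> vgt (level x) (coeff (shifted x) u)"
    and dvd: "\<And>i. i \<le> k \<Longrightarrow> n i < n (leading x) \<Longrightarrow>
      int CHAR('a) dvd (\<Sum>u\<in>U. w u * int (n i choose u))"
  shows "int CHAR('a) dvd (\<Sum>u\<in>U. w u * int (n (leading x) choose u))"
proof (rule ccontr)
  let ?\<phi> = "\<lambda>i. \<Sum>u\<in>U. w u * int (n i choose u)" and ?t = "leading x"
  assume nd: "\<not> int CHAR('a) dvd ?\<phi> ?t"
  note unit = v_of_int_eq_0[OF prime_char nd]
  have lev: "v (summand x ?t * of_int (?\<phi> ?t)) = level x"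
    using v_mult[OF summand_nonzero[OF x leading_le] unit(1)] unit(2) by simp
  have "\<not> vgt (v (summand x ?t * of_int (?\<phi> ?t))) (\<Sum>i\<le>k. summand x i * of_int (?\<phi> i))"
  proof (rule sum_unique_min)
    fix i
    assume i: "i \<in> {..k} - {?t}"
    show "vgt (v (summand x ?t * of_int (?\<phi> ?t))) (summand x i * of_int (?\<phi> i))"
    proof (cases "n i < n ?t")
      case True
      with dvd[of i] i have "of_int (?\<phi> i) = (0::'a)"
        by (simp only: of_int_eq_0_iff_char_dvd) simp
      then show ?thesis by (simp only: mult_zero_right vgt_zero)
    next
      case False
      have "n i \<noteq> n ?t"
        using inj_n leading_le i by (auto dest: inj_onD)
      with False summand_leading_less[of i x] i have "vgt (level x) (summand x i)"
        by (simp add: vgt_def)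
      then show ?thesis
        unfolding lev by (rule vgt_mult) (rule vge_of_int)
    qed
  qed (use leading_le[of x] summand_nonzero[OF x leading_le] unit(1) in auto)
  moreover have "vgt (level x) (\<Sum>u\<in>U. of_int (w u) * coeff (shifted x) u)"
    by (intro vgt_sum, subst mult.commute) (intro vgt_mult U vge_of_int)
  ultimately show False
    unfolding lev combination_eq by blast
qed

text \<open>Let \<open>m\<close> be the largest pivot whose weight is nonzero modulo the
  characteristic. For \<open>m > 0\<close>, the coefficient at \<open>m\<close> has strictly smaller
  value than all earlier ones, so the combination of coefficients cannot vanish.\<close>

lemma pivots_independent:
  assumes x: "x \<noteq> 0" "poly f x = 0" and "finite (pivots x)"
    and dvd: "\<And>i. i \<le> k \<Longrightarrow> int CHAR('a) dvd (\<Sum>u\<in>pivots x. w u * int (n i choose u))"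
    and "u \<in> pivots x"
  shows "int CHAR('a) dvd w u"
proof (rule ccontr)
  let ?c = "coeff (shifted x)"
  let ?B = "{u \<in> pivots x. \<not> int CHAR('a) dvd w u}"
  assume "\<not> ?thesis"
  then have "?B \<noteq> {}" "finite ?B" using assms by auto
  define m where "m = Max ?B"
  have m: "m \<in> pivots x" "\<not> int CHAR('a) dvd w m"
    using Max_in[OF \<open>finite ?B\<close> \<open>?B \<noteq> {}\<close>] by (auto simp: m_def)
  have above: "of_int (w u) = (0::'a)" if "u \<in> pivots x" "m < u" for u
  proof -
    have "u \<notin> ?B"
      using Max_ge[OF \<open>finite ?B\<close>, of u] that by (auto simp: m_def)
    with that show ?thesis by (simp add: of_int_eq_0_iff_char_dvd)
  qed
  note unit = v_of_int_eq_0[OF prime_char m(2)]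
  show False
  proof (cases "m = 0")
    \<comment> \<open>The coefficient at 0 is \<open>poly f x = 0\<close>, so values say nothing
      here. But column 0 consists of ones, so a single row already yields
      \<open>w 0\<close>.\<close>
    case True
    have "of_int (\<Sum>u\<in>pivots x. w u * int (n 0 choose u)) = (\<Sum>u\<in>pivots x. of_int (w u) * (of_int (int (n 0 choose u)) :: 'a))"
      by simp
    also have "\<dots> = (\<Sum>u\<in>pivots x. if u = 0 then of_int (w 0) else 0)"
      using above True by (intro sum.cong) auto
    also have "\<dots> = of_int (w 0)"
      using assms(3) by (simp add: pivots_def)
    also have "of_int (\<Sum>u\<in>pivots x. w u * int (n 0 choose u)) = (0::'a)"
      using dvd[of 0] by (simp only: of_int_eq_0_iff_char_dvd le0)
    finally show False using unit True by simp
  next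
    case False
    then obtain y where y: "y \<in> near x" "m = pivot (shifted x) y"
      using m(1) by (auto simp: pivots_def)
    then have yy: "y \<noteq> 0" "0 < v y" by (auto simp: near_def)
    note nz = shifted_nonzero[OF x(1)]
    have cm: "?c m \<noteq> 0" using coeff_pivot[OF nz yy(1)] y by simp
    have lev: "v (of_int (w m) * ?c m) = v (?c m)"
      using v_mult[OF unit(1) cm] unit(2) by simp
    have "\<not> vgt (v (of_int (w m) * ?c m)) (\<Sum>u\<in>pivots x. of_int (w u) * ?c u)"
    proof (rule sum_unique_min)
      fix u
      assume u: "u \<in> pivots x - {m}"
      show "vgt (v (of_int (w m) * ?c m)) (of_int (w u) * ?c u)"
      proof (cases "m < u")
        case True
        with above u show ?thesis by simp
      next
        case False
        with u have "u < pivot (shifted x) y" using y by simp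
        from coeff_below_pivot[OF nz yy this] have "vgt (v (?c m)) (?c u)"
          using y by simp
        then show ?thesis
          unfolding lev by (subst mult.commute) (intro vgt_mult vge_of_int)
      qed
    qed (use assms m unit cm in auto)
    moreover have "(\<Sum>u\<in>pivots x. of_int (w u) * ?c u) = 0"
      unfolding combination_eq[symmetric]
    proof (rule sum.neutral, rule ballI)
      fix i
      assume "i \<in> {..k}"
      with dvd[of i] have "of_int (\<Sum>u\<in>pivots x. w u * int (n i choose u)) = (0::'a)"
        by (simp only: of_int_eq_0_iff_char_dvd) simp
      then show "summand x i * of_int (\<Sum>u\<in>pivots x. w u * int (n i choose u)) = 0"
        by (simp only: mult_zero_right)
    qed
    ultimately show False by simp
  qed
qed

text \<open>At a nonzero pivot the coefficient is not minimal, and below it the values are larger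
  still; at 0 the coefficient is \<open>poly f x = 0\<close>.\<close>

lemma coeff_le_pivots:
  assumes x: "x \<noteq> 0" "poly f x = 0" and u: "u \<in> pivots x" and "j \<le> u"
  shows "vgt (level x) (coeff (shifted x) j)"
proof (cases "u = 0")
  case True
  with assms show ?thesis
    by (simp add: shifted_def)
next
  case False
  then obtain y where y: "y \<in> near x" "u = pivot (shifted x) y"
    using u by (auto simp: pivots_def)
  then have yy: "y \<noteq> 0" "0 < v y" "poly (shifted x) y = 0" by (auto simp: near_def)
  note nz = shifted_nonzero[OF x(1)]
  have "vgt (level x) (coeff (shifted x) u)"
    unfolding y(2) using nz yy(1,3,2) coeff_shifted_level[OF x(1)] by (rule coeff_pivot_not_minimal)
  moreover have "vgt (v (coeff (shifted x) u)) (coeff (shifted x) j)" if "j < u"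
    using coeff_below_pivot[OF nz yy(1,2)] that y by simp
  ultimately show ?thesis
    using assms(4) coeff_pivot[OF nz yy(1)] y(2) by (cases "j = u") (auto simp: vgt_def)
qed

lemma finite_near: "x \<noteq> 0 \<Longrightarrow> finite (near x)"
  by (rule finite_subset[OF _ poly_roots_finite[OF shifted_nonzero]]) (auto simp: near_def)

text \<open>The pivot determines \<open>v y\<close>, so there are at least as many nonzero pivots as
  values; 0 is no pivot of a near root because the constant coefficient vanishes.\<close>

lemma card_pivots:
  assumes x: "x \<noteq> 0" "poly f x = 0"
  shows "Suc (card (v ` near x)) \<le> card (pivots x)"
proof -
  let ?F = "shifted x"
  note nz = shifted_nonzero[OF x(1)]
  have "v (inv_into (near x) (pivot ?F) (pivot ?F y)) = v y" if "y \<in> near x" for y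
    using pivot_eq_iff[OF nz, of "inv_into (near x) (pivot ?F) (pivot ?F y)" y]
      inv_into_into[of "pivot ?F y" "pivot ?F" "near x"]
      f_inv_into_f[of "pivot ?F y" "pivot ?F" "near x"] that
    by (auto simp: near_def)
  then have "v ` near x \<subseteq> (\<lambda>u. v (inv_into (near x) (pivot ?F) u)) ` (pivot ?F ` near x)"
    by (force simp: image_image)
  then have "card (v ` near x) \<le> card (pivot ?F ` near x)"
    using finite_near[OF x(1)] by (meson card_image_le card_mono finite_imageI order_trans)
  moreover have "0 \<notin> pivot ?F ` near x"
  proof
    assume "0 \<in> pivot ?F ` near x"
    then obtain y where "y \<in> near x" "pivot ?F y = 0" by auto
    with coeff_pivot[OF nz, of y] x show False
      by (simp add: near_def shifted_def)
  qed
  ultimately show ?thesis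
    using finite_near[OF x(1)] by (simp add: pivots_def)
qed

lemma card_values_le:
  assumes A: "finite A" "A \<noteq> {}" "inj_on v A" "\<And>x. x \<in> A \<Longrightarrow> x \<noteq> 0 \<and> poly f x = 0"
    and d: "\<And>x. x \<in> A \<Longrightarrow> d \<le> card (v ` near x)"
  shows "card A + d \<le> k"
proof -
  have fin: "finite (pivots x)" if "x \<in> A" for x
    using that A(4) finite_near by (simp add: pivots_def)
  \<comment> \<open>With the least maximal pivot, all pivot columns of \<open>x\<close> lie below
    the last pivot of every \<open>y\<close> in \<open>A\<close>, so \<open>coeff_le_pivots\<close>
    covers them for each \<open>y\<close>.\<close>
  obtain x where x: "x \<in> A" and min: "\<And>y. y \<in> A \<Longrightarrow> Max (pivots x) \<le> Max (pivots y)"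
    using ex_is_arg_min_if_finite[OF A(1,2), of "\<lambda>x. Max (pivots x)"]
    by (auto simp: is_arg_min_def not_less)
  let ?U = "pivots x" and ?N = "{..k} - leading ` A"
  have small: "vgt (level y) (coeff (shifted y) u)" if "y \<in> A" "u \<in> ?U" for y u
  proof (rule coeff_le_pivots)
    show "Max (pivots y) \<in> pivots y"
      using fin[OF that(1)] by (intro Max_in) (auto simp: pivots_def)
    show "u \<le> Max (pivots y)"
      using Max_ge[OF fin[OF x] that(2)] min[OF that(1)] by simp
  qed (use A that in auto)
  \<comment> \<open>A combination of the pivot columns of \<open>x\<close> that vanishes on the rows in \<open>?N\<close> vanishes on all
    rows, since the leading rows depend on earlier ones in all columns up to \<open>Max (pivots x)\<close>.\<close>
  have "card ?U \<le> card ?N"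
  proof (rule card_le_if_columns_independent)
    show "finite ?U" by (rule fin[OF x])
    show "1 < CHAR('a)" by (rule prime_gt_1_nat[OF prime_char])
    fix w u
    assume dvd: "\<And>i. i \<in> ?N \<Longrightarrow> int CHAR('a) dvd (\<Sum>u\<in>?U. w u * int (n i choose u))"
      and u: "u \<in> ?U"
    have "int CHAR('a) dvd (\<Sum>u\<in>?U. w u * int (n i choose u))" if "i \<le> k" for i
      using that
    \<comment> \<open>Induction on exponents: the earlier rows on which a leading row depends may
      themselves be leading rows of other elements of \<open>A\<close>.\<close>
    proof (induction "n i" arbitrary: i rule: less_induct)
      case less
      show ?case
      proof (cases "i \<in> leading ` A")
        case True
        then obtain y where y: "y \<in> A" "i = leading y" by auto
        show ?thesis
          unfolding y(2) by (rule dvd_leading_row) (use y A(4) small less in auto)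
      next
        case False
        with less dvd show ?thesis by simp
      qed
    qed
    then show "int CHAR('a) dvd w u"
      using pivots_independent[of x w u] A(4)[OF x] fin[OF x] u by blast
  qed simp
  moreover have "inj_on leading A"
  proof (rule inj_onI, rule ccontr)
    fix y z
    assume yz: "y \<in> A" "z \<in> A" "leading y = leading z" "y \<noteq> z"
    then have "v y \<noteq> v z" using A(3) by (auto dest: inj_onD)
    with yz A(4) leading_distinct[of y z] leading_distinct[of z y] show False
      by (metis linorder_neqE)
  qed
  then have "card ?N = Suc k - card A"
    using A(1) leading_le by (subst card_Diff_subset) (auto simp: card_image)
  moreover have "Suc d \<le> card ?U"
    using card_pivots[of x] A(4)[OF x] d[OF x] by linarith
  ultimately show ?thesis by linarith
qed

section \<open>Counting the roots by value\<close>

lemma card_roots_with_value: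
  assumes fin: "finite (residue_field v)"
    and d: "\<And>x. x \<noteq> 0 \<Longrightarrow> poly f x = 0 \<Longrightarrow> v x = g \<Longrightarrow> card (v ` near x) \<le> d"
  shows "card {x. x \<noteq> 0 \<and> poly f x = 0 \<and> v x = g}
    \<le> (card (residue_field v) - 1) * card (residue_field v) ^ d"
proof -
  let ?Z = "{x. x \<noteq> 0 \<and> poly f x = 0 \<and> v x = g}" and ?q = "card (residue_field v)"
  have finZ: "finite ?Z"
    by (rule finite_subset[OF _ finite_roots]) auto
  \<comment> \<open>Inside one coset, the differences from \<open>z\<close> have values
    \<open>g + h\<close> with \<open>h\<close> the value of an element of
    \<open>near z\<close>.\<close>
  have "card {y \<in> ?Z. vgt g (x - y)} \<le> ?q ^ d" if "x \<in> ?Z" for x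
  proof (rule card_le_by_distances[OF fin])
    let ?C = "{y \<in> ?Z. vgt g (x - y)}"
    show "finite ?C" by (rule finite_subset[OF _ finZ]) blast
    fix z
    assume z: "z \<in> ?C"
    then have z': "z \<noteq> 0" "poly f z = 0" "v z = g" by auto
    have "v (y - z) \<in> (\<lambda>h. g + h) ` (v ` near z)" if y: "y \<in> ?C - {z}" for y
    proof -
      have "vgt g (y - z)"
        using vgt_diff[of g "x - z" "x - y"] y z by auto
      then have "(y - z) / z \<in> near z"
        using y z' vgt_divide[of z "y - z"] by (auto simp: near_def poly_shifted vgt_def)
      moreover have "v (y - z) = g + v ((y - z) / z)"
        using y z' by (auto simp: v_divide)
      ultimately show ?thesis by blast
    qed
    then have "(\<lambda>y. v (y - z)) ` (?C - {z}) \<subseteq> (\<lambda>h. g + h) ` (v ` near z)"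
      by blast
    then have "card ((\<lambda>y. v (y - z)) ` (?C - {z})) \<le> card (v ` near z)"
      using finite_near[OF z'(1)] by (meson card_image_le card_mono finite_imageI order_trans)
    also have "\<dots> \<le> d" using d z' by blast
    finally show "card ((\<lambda>y. v (y - z)) ` (?C - {z})) \<le> d" .
  qed
  from ex_separated[OF finZ this] obtain S
    where S: "S \<subseteq> ?Z" "card ?Z \<le> card S * ?q ^ d"
      "\<And>x y. x \<in> S \<Longrightarrow> y \<in> S \<Longrightarrow> vgt g (x - y) \<Longrightarrow> x = y"
    by blast
  have "card S \<le> ?q - 1"
  proof (cases "S = {}")
    case False
    then obtain b where b: "b \<in> S" by blast
    with S(1) have b': "b \<noteq> 0" "v b = g" by auto
    have unit: "x \<noteq> 0" "v x = g" if "x \<in> S" for x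
      using that S(1) by auto
    \<comment> \<open>All elements of \<open>S\<close> have value exactly \<open>g\<close>, so 0 can
      be adjoined as a further separated point; this gives \<open>q - 1\<close>.\<close>
    have "card (insert 0 S) \<le> ?q"
    proof (rule card_separated_le[OF fin b'(1), of _ 0])
      show "vge (v b) (x - 0)" if "x \<in> insert 0 S" for x
        using that unit b' by (auto simp: vge_def)
      show "x = y" if "x \<in> insert 0 S" "y \<in> insert 0 S" "vgt (v b) (x - y)" for x y
        using that unit b' S(3)[of x y] by (auto simp: vgt_def)
    qed
    moreover have "0 \<notin> S" using unit(1) by blast
    moreover have "finite S" using S(1) finZ by (rule finite_subset)
    ultimately show ?thesis by simp
  qed simp
  with S(2) show ?thesis
    by (meson le_trans mult_le_mono1)
qed

lemma card_roots_le:
  assumes fin: "finite (residue_field v)"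
  shows "card {x. poly f x = 0} \<le> card (residue_field v) ^ k"
proof -
  let ?q = "card (residue_field v)"
  define Z where "Z = {x. x \<noteq> 0 \<and> poly f x = 0}"
  \<comment> \<open>The largest number of relative distances seen from a root of value
    \<open>g\<close>; \<open>r g\<close> below is a root attaining it.\<close>
  define d where "d g = Max ((\<lambda>x. card (v ` near x)) ` {x \<in> Z. v x = g})" for g
  have finZ: "finite Z"
    by (rule finite_subset[OF _ finite_roots]) (auto simp: Z_def)
  have d_ge: "card (v ` near x) \<le> d (v x)" if "x \<in> Z" for x
    unfolding d_def using that finZ by (intro Max_ge) auto
  have "\<exists>x\<in>Z. v x = g \<and> card (v ` near x) = d g" if "g \<in> v ` Z" for g
  proof -
    have "d g \<in> (\<lambda>x. card (v ` near x)) ` {x \<in> Z. v x = g}"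
      unfolding d_def using that finZ by (intro Max_in) auto
    then show ?thesis by auto
  qed
  then obtain r where r: "\<And>g. g \<in> v ` Z \<Longrightarrow> r g \<in> Z \<and> v (r g) = g \<and> card (v ` near (r g)) = d g"
    by metis
  have "card {h \<in> v ` Z. d g \<le> d h} + d g \<le> k" if g: "g \<in> v ` Z" for g
  proof -
    let ?H = "{h \<in> v ` Z. d g \<le> d h}"
    have "inj_on r ?H"
      using r by (intro inj_on_inverseI[of _ v]) blast
    then have "card ?H = card (r ` ?H)"
      by (simp add: card_image)
    \<comment> \<open>Each root \<open>r h\<close> with \<open>h\<close> in \<open>?H\<close> sees
      \<open>d h \<ge> d g\<close> relative distances.\<close>
    moreover have "card (r ` ?H) + d g \<le> k"
    proof (rule card_values_le)
      show "inj_on v (r ` ?H)"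
        using r by (intro inj_on_inverseI[of _ r]) auto
    qed (use finZ g r in \<open>auto simp: Z_def\<close>)
    ultimately show ?thesis by simp
  qed
  moreover have "?q > 0"
    using card_separated_le[OF fin, of 1 "{0}" 0] by simp
  ultimately have less: "(?q - 1) * (\<Sum>g\<in>v ` Z. ?q ^ d g) < ?q ^ k"
    using finZ by (intro sum_power_less) auto
  have "Z = (\<Union>g\<in>v ` Z. {x. x \<noteq> 0 \<and> poly f x = 0 \<and> v x = g})"
    by (auto simp: Z_def)
  then have "card Z = card (\<Union>g\<in>v ` Z. {x. x \<noteq> 0 \<and> poly f x = 0 \<and> v x = g})"
    by (rule arg_cong)
  also have "\<dots> \<le> (\<Sum>g\<in>v ` Z. card {x. x \<noteq> 0 \<and> poly f x = 0 \<and> v x = g})"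
    using finZ by (intro card_UN_le) simp
  also have "\<dots> \<le> (\<Sum>g\<in>v ` Z. (?q - 1) * ?q ^ d g)"
    using d_ge by (intro sum_mono card_roots_with_value[OF fin]) (auto simp: Z_def)
  also have "\<dots> = (?q - 1) * (\<Sum>g\<in>v ` Z. ?q ^ d g)"
    by (simp add: sum_distrib_left)
  finally have "card Z < ?q ^ k"
    using less by simp
  \<comment> \<open>The strict bound on the nonzero roots leaves room for the root 0.\<close>
  moreover have "card {x. poly f x = 0} \<le> card (insert 0 Z)"
    using finZ by (intro card_mono) (auto simp: Z_def)
  moreover have "card (insert 0 Z) \<le> Suc (card Z)"
    using finZ by (simp add: card_insert_if)
  ultimately show ?thesis by linarith
qed

end

theorem theorem1:
  fixes v :: "'a::field \<Rightarrow> 'g::linordered_ab_group_add"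
    and p q k :: nat
    and a :: "nat \<Rightarrow> 'a"
    and n :: "nat \<Rightarrow> nat"
    and f :: "'a poly"
  assumes "prime p"
    and "CHAR('a) = p"
    and "valuation v"
    and "finite (residue_field v)"
    and "card (residue_field v) = q"
    and "inj_on n {..k}"
    and "\<And>i. i \<le> k \<Longrightarrow> a i \<noteq> 0"
    and "f = (\<Sum>i\<le>k. monom (a i) (n i))"
  shows "finite {x. poly f x = 0} \<and> card {x. poly f x = 0} \<le> q ^ k"
proof -
  interpret sparse_polynomial v k a n
    using assms by unfold_locales auto
  show ?thesis
    using finite_roots card_roots_le assms(4,5,8) unfolding f_def by simp
qed

end
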